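(* Let $p$ and $q$ be primes with $p \mid (q-1)$ and let $G$ be a non-abelian group of order $pq$. Then the Laplacian spectrum of the non-commuting graph $\mathcal{A}_G$ of $G$ is $$\{0, (pq-q)^{q-2}, (pq-p)^{pq-2q}, (pq-1)^q\}.$$
   Context: For a finite non-abelian group $G$ with centre $Z(G)$, the non-commuting graph $\mathcal{A}_G$ is the simple undirected graph with vertex set $G \setminus Z(G)$ in which two vertices $x,y$ are adjacent if and only if $xy \neq yx$. The Laplacian matrix of a finite graph is $D - A$, with $D$ the degree matrix and $A$ the adjacency matrix. The Laplacian spectrum is the multiset of eigenvalues of the Laplacian matrix; $\{\dots,\alpha^{a},\dots\}$ means the eigenvalue $\alpha$ is listed with multiplicity $a$ (not a power; no exponent means once, exponent $0$ means the entry is absent, and if listed values coincide their multiplicities add). *)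

theory Defs
  imports
    "HOL-Algebra.Coset"
    "HOL-Computational_Algebra.Primes"
    "Graph_Theory.Pair_Digraph"
    "Jordan_Normal_Form.Char_Poly"
begin

definition group_centre :: "('a, 'm) monoid_scheme \<Rightarrow> 'a set" where
  "group_centre G = {z \<in> carrier G. \<forall>x \<in> carrier G. z \<otimes>\<^bsub>G\<^esub> x = x \<otimes>\<^bsub>G\<^esub> z}"

(* An undirected graph is represented as a symmetric digraph, as in Graph_Theory:
   the edge {x, y} is the pair of arcs (x, y), (y, x). *)
definition non_commuting_graph :: "('a, 'm) monoid_scheme \<Rightarrow> 'a pair_pre_digraph" where
  "non_commuting_graph G =
    \<lparr>pverts = carrier G - group_centre G,
     parcs = {(x, y). x \<in> carrier G - group_centre G \<and> y \<in> carrier G - group_centre G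
                        \<and> x \<otimes>\<^bsub>G\<^esub> y \<noteq> y \<otimes>\<^bsub>G\<^esub> x}\<rparr>"

lemma pair_graph_non_commuting_graph:
  assumes "finite (carrier G)"
  shows "pair_graph (non_commuting_graph G)"
proof -
  let ?H = "non_commuting_graph G"
  have V: "finite (pverts ?H)"
    using assms by (simp add: non_commuting_graph_def)
  have sub: "parcs ?H \<subseteq> pverts ?H \<times> pverts ?H"
    by (auto simp: non_commuting_graph_def)
  have A: "finite (parcs ?H)"
    by (rule finite_subset[OF sub]) (use V in simp)
  have S: "sym (parcs ?H)"
    by (auto simp: non_commuting_graph_def sym_def)
  show ?thesis
    by unfold_locales
      (use V A S sub in \<open>auto simp: symmetric_def\<close>, auto simp: non_commuting_graph_def)
qed

(* The list vs enumerates the vertices and thereby indexes the rows and columns.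
   For a symmetric digraph the out-degree of a vertex is its degree as an undirected graph. *)
definition adjacency_mat :: "'a pair_pre_digraph \<Rightarrow> 'a list \<Rightarrow> real mat" where
  "adjacency_mat H vs =
    mat (length vs) (length vs) (\<lambda>(i, j). if (vs ! i, vs ! j) \<in> parcs H then 1 else 0)"

definition degree_mat :: "'a pair_pre_digraph \<Rightarrow> 'a list \<Rightarrow> real mat" where
  "degree_mat H vs =
    mat (length vs) (length vs)
      (\<lambda>(i, j). if i = j then real (out_degree (with_proj H) (vs ! i)) else 0)"

definition laplacian_mat :: "'a pair_pre_digraph \<Rightarrow> 'a list \<Rightarrow> real mat" where
  "laplacian_mat H vs = degree_mat H vs - adjacency_mat H vs"

(* Eigenvalues are counted with algebraic multiplicity, as roots of the characteristic polynomial.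
   No root is lost over the reals, because the Laplacian matrix of an undirected graph is symmetric.
   The enumeration of the vertices is irrelevant: see laplacian_spectrum_eq below. *)
definition laplacian_spectrum :: "'a pair_pre_digraph \<Rightarrow> real multiset" where
  "laplacian_spectrum H =
    proots (char_poly (laplacian_mat H (SOME vs. distinct vs \<and> set vs = pverts H)))"

lemma similar_mat_reindex:
  fixes h :: "'a \<Rightarrow> 'a \<Rightarrow> real"
  assumes "distinct vs" "distinct ws" "set vs = set ws" "length vs = n" "length ws = n"
  shows "similar_mat (mat n n (\<lambda>(i, j). h (vs ! i) (vs ! j)))
                     (mat n n (\<lambda>(i, j). h (ws ! i) (ws ! j)))"
    (is "similar_mat ?A ?B")
proof -
  define P Q :: "real mat"
    where "P = mat n n (\<lambda>(i, j). if vs ! i = ws ! j then 1 else 0)"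
      and "Q = mat n n (\<lambda>(i, j). if ws ! i = vs ! j then 1 else 0)"
  have ex: "\<exists>k<n. us ! k = x" if "x \<in> set us" "length us = n" for us :: "'a list" and x
    using that by (auto simp: in_set_conv_nth)
  have sum1: "(\<Sum>k\<in>{0..<n}. (if x = us ! k then 1 else 0) * g (us ! k)) = g x"
    if us: "distinct us" "length us = n" "x \<in> set us" for us and x :: 'a and g :: "'a \<Rightarrow> real"
  proof -
    from ex[OF us(3,2)] obtain k where k: "k < n" "us ! k = x" by blast
    have "(\<Sum>i\<in>{0..<n}. (if x = us ! i then 1 else 0) * g (us ! i))
        = (\<Sum>i\<in>{0..<n}. if i = k then g x else 0)"
      using us k by (intro sum.cong) (auto simp: nth_eq_iff_index_eq)
    then show ?thesis using k by simp
  qed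
  have sum2: "(\<Sum>k\<in>{0..<n}. g (us ! k) * (if us ! k = x then 1 else 0)) = g x"
    if us: "distinct us" "length us = n" "x \<in> set us" for us and x :: 'a and g :: "'a \<Rightarrow> real"
  proof -
    have "(\<Sum>k\<in>{0..<n}. g (us ! k) * (if us ! k = x then 1 else 0))
        = (\<Sum>k\<in>{0..<n}. (if x = us ! k then 1 else 0) * g (us ! k))"
      by (rule sum.cong) auto
    also have "\<dots> = g x" by (rule sum1[OF us])
    finally show ?thesis .
  qed
  have mem: "vs ! i \<in> set ws" "ws ! i \<in> set vs" if "i < n" for i
    using that assms nth_mem by metis+
  have prod: "mat n n (\<lambda>(i, j). f i j) * mat n n (\<lambda>(i, j). g i j)
      = mat n n (\<lambda>(i, j). \<Sum>k\<in>{0..<n}. f i k * g k j)" for f g :: "nat \<Rightarrow> nat \<Rightarrow> real"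
    by (rule eq_matI) (auto simp: scalar_prod_def)
  have PQ: "P * Q = 1\<^sub>m n"
    unfolding P_def Q_def prod
  proof (rule eq_matI)
    fix i j assume "i < dim_row (1\<^sub>m n :: real mat)" "j < dim_col (1\<^sub>m n :: real mat)"
    then have ij: "i < n" "j < n" by simp_all
    have "(\<Sum>k\<in>{0..<n}. (if vs ! i = ws ! k then 1 else 0) * (if ws ! k = vs ! j then 1 else 0))
        = (if vs ! i = vs ! j then 1 else (0::real))"
      by (rule sum1[where g = "\<lambda>x. if x = vs ! j then 1 else 0"]) (use assms mem ij in simp_all)
    with ij assms show "mat n n (\<lambda>(i, j). \<Sum>k\<in>{0..<n}. (if vs ! i = ws ! k then 1 else 0) *
        (if ws ! k = vs ! j then 1 else 0)) $$ (i, j) = (1\<^sub>m n :: real mat) $$ (i, j)"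
      by (simp only: index_mat(1) index_one_mat(1) split nth_eq_iff_index_eq)
  qed simp_all
  have QP: "Q * P = 1\<^sub>m n"
    unfolding P_def Q_def prod
  proof (rule eq_matI)
    fix i j assume "i < dim_row (1\<^sub>m n :: real mat)" "j < dim_col (1\<^sub>m n :: real mat)"
    then have ij: "i < n" "j < n" by simp_all
    have "(\<Sum>k\<in>{0..<n}. (if ws ! i = vs ! k then 1 else 0) * (if vs ! k = ws ! j then 1 else 0))
        = (if ws ! i = ws ! j then 1 else (0::real))"
      by (rule sum1[where g = "\<lambda>x. if x = ws ! j then 1 else 0"]) (use assms mem ij in simp_all)
    with ij assms show "mat n n (\<lambda>(i, j). \<Sum>k\<in>{0..<n}. (if ws ! i = vs ! k then 1 else 0) *
        (if vs ! k = ws ! j then 1 else 0)) $$ (i, j) = (1\<^sub>m n :: real mat) $$ (i, j)"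
      by (simp only: index_mat(1) index_one_mat(1) split nth_eq_iff_index_eq)
  qed simp_all
  have PB: "P * ?B = mat n n (\<lambda>(i, j). h (vs ! i) (ws ! j))"
    unfolding P_def prod
  proof (rule cong_mat; simp only: split)
    fix i j assume ij: "i < n" "j < n"
    show "(\<Sum>k\<in>{0..<n}. (if vs ! i = ws ! k then 1 else 0) * h (ws ! k) (ws ! j))
        = h (vs ! i) (ws ! j)"
      by (rule sum1[where g = "\<lambda>x. h x (ws ! j)"]) (use assms mem ij in simp_all)
  qed
  have PBQ: "P * ?B * Q = ?A"
    unfolding PB unfolding Q_def prod
  proof (rule cong_mat; simp only: split)
    fix i j assume ij: "i < n" "j < n"
    show "(\<Sum>k\<in>{0..<n}. h (vs ! i) (ws ! k) * (if ws ! k = vs ! j then 1 else 0))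
        = h (vs ! i) (vs ! j)"
      by (rule sum2[where g = "\<lambda>x. h (vs ! i) x"]) (use assms mem ij in simp_all)
  qed
  have "similar_mat_wit ?A ?B P Q"
    by (rule similar_mat_witI[OF PQ QP PBQ[symmetric]]) (auto simp: P_def Q_def)
  then show ?thesis
    by (auto simp: similar_mat_def)
qed

lemma laplacian_spectrum_eq:
  assumes vs: "distinct vs" "set vs = pverts H"
  shows "laplacian_spectrum H = proots (char_poly (laplacian_mat H vs))"
proof -
  define ws where "ws = (SOME vs. distinct vs \<and> set vs = pverts H)"
  have ws: "distinct ws \<and> set ws = pverts H"
    unfolding ws_def by (rule someI[of _ vs]) (use vs in simp)
  define n where "n = length vs"
  have len: "length ws = n"
    using vs ws distinct_card unfolding n_def by metis
  define h where "h x y = (if x = y then real (out_degree (with_proj H) x) else 0)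
      - (if (x, y) \<in> parcs H then 1 else 0)" for x y
  have L: "laplacian_mat H us = mat n n (\<lambda>(i, j). h (us ! i) (us ! j))"
    if "distinct us" "length us = n" for us
    using that
    by (intro eq_matI)
      (auto simp: laplacian_mat_def degree_mat_def adjacency_mat_def h_def nth_eq_iff_index_eq)
  have "similar_mat (laplacian_mat H ws) (laplacian_mat H vs)"
    unfolding L[OF conjunct1[OF ws] len] L[OF vs(1) n_def[symmetric]]
    by (rule similar_mat_reindex) (use vs ws len in \<open>simp_all add: n_def\<close>)
  then show ?thesis
    unfolding laplacian_spectrum_def ws_def[symmetric] by (simp add: char_poly_similar)
qed

end

theory Submission
  imports Defs "HOL-Algebra.Sylow" "HOL-Library.Disjoint_Sets"
begin

text \<open>In a non-abelian group of order $pq$ the centralizers of the non-identity elements are subgroups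
  of prime order, so two of them coincide or meet in the identity only. Hence the non-commuting
  graph is complete multipartite, its parts being these subgroups with the identity removed. By
  Sylow there is a subgroup of order $q$; since $q^2 > pq$ it is the only one, and counting the
  remaining elements gives $q$ subgroups of order $p$.

  For a complete multipartite graph on $n$ vertices an eigenbasis of the Laplacian can be written
  down: the constant function ($0$), differences of point masses in a part $B$ ($n - |B|$), and
  differences of normalized indicators of two parts ($n$).\<close>

section \<open>Complete multipartite graphs\<close>

lemma proots_prod_list_linear:
  "proots (\<Prod>a\<leftarrow>xs. [:- a, 1:]) = mset (xs :: 'a :: idom list)"
proof (induction xs)
  case (Cons a xs)
  have "(\<Prod>a\<leftarrow>xs. [:- a, 1:]) \<noteq> 0"
    by (auto simp: prod_list_zero_iff)
  with Cons show ?case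
    by (simp add: proots_mult del: mult_pCons_left)
qed simp

text \<open>The columns of \<open>P\<close> are eigenvectors of \<open>h\<close> with eigenvalues
  \<open>d\<close>, and \<open>Q\<close> is the inverse of \<open>P\<close>, so the matrix of
  \<open>h\<close> is similar to the diagonal matrix of \<open>d\<close>. Rows and columns are
  indexed by the elements of \<open>vs\<close> themselves, so that both hypotheses are sums over a
  set and can be checked without an enumeration.\<close>

lemma proots_char_poly_eigenbasis:
  fixes h P Q :: "'a \<Rightarrow> 'a \<Rightarrow> 'b :: field" and d :: "'a \<Rightarrow> 'b"
  assumes vs: "distinct vs" "length vs = n"
    and QP: "\<And>x y. x \<in> set vs \<Longrightarrow> y \<in> set vs \<Longrightarrow>
      (\<Sum>z\<in>set vs. Q x z * P z y) = (if x = y then 1 else 0)"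
    and hP: "\<And>x y. x \<in> set vs \<Longrightarrow> y \<in> set vs \<Longrightarrow>
      (\<Sum>z\<in>set vs. h x z * P z y) = P x y * d y"
  shows "proots (char_poly (mat n n (\<lambda>(i, j). h (vs ! i) (vs ! j)))) = image_mset d (mset vs)"
proof -
  define M where "M f = mat n n (\<lambda>(i, j). f (vs ! i) (vs ! j))" for f :: "'a \<Rightarrow> 'a \<Rightarrow> 'b"
  define D where "D x y = (if x = y then d y else 0)" for x y
  have carr [simp]: "M f \<in> carrier_mat n n" for f
    by (simp add: M_def)
  have mem [simp]: "vs ! i \<in> set vs" if "i < n" for i
    using that vs by simp
  have M_cong: "M f = M g" if "\<And>x y. x \<in> set vs \<Longrightarrow> y \<in> set vs \<Longrightarrow> f x y = g x y" for f g
    unfolding M_def by (rule cong_mat) (simp_all add: that)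
  have sum_nth: "(\<Sum>k = 0..<n. f (vs ! k)) = sum f (set vs)" for f :: "'a \<Rightarrow> 'b"
    using sum.reindex_bij_betw[OF bij_betw_nth[OF vs(1) refl refl], of f] vs(2)
    by (simp add: atLeast0LessThan)
  have M_mult: "M f * M g = M (\<lambda>x y. \<Sum>z\<in>set vs. f x z * g z y)" for f g
    by (rule eq_matI)
      (simp_all add: M_def scalar_prod_def sum_nth[symmetric] cong: sum.cong_simp)
  have M_one: "M (\<lambda>x y. if x = y then 1 else 0) = 1\<^sub>m n"
    by (rule eq_matI) (use vs in \<open>simp_all add: M_def nth_eq_iff_index_eq\<close>)
  have QP1: "M Q * M P = 1\<^sub>m n"
    unfolding M_mult M_one[symmetric] by (rule M_cong) (rule QP)
  \<comment> \<open>A one-sided inverse of a square matrix is two-sided, so one duality relation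
    suffices.\<close>
  then have PQ1: "M P * M Q = 1\<^sub>m n"
    by (rule mat_mult_left_right_inverse[rotated 2]) simp_all
  have "M h * M P = M P * M D"
    unfolding M_mult by (rule M_cong) (simp add: hP D_def if_distrib cong: if_cong)
  then have "M P * M D * M Q = M h * M P * M Q"
    by simp
  also have "\<dots> = M h * (M P * M Q)"
    by (rule assoc_mult_mat[of _ n n _ n _ n]) simp_all
  finally have "M P * M D * M Q = M h * (M P * M Q)" .
  then have "M h = M P * M D * M Q"
    by (simp add: PQ1 right_mult_one_mat[of _ n n])
  from similar_mat_witI[OF PQ1 QP1 this carr carr carr carr]
  have "similar_mat_wit (M h) (M D) (M P) (M Q)" .
  then have "char_poly (M h) = char_poly (M D)"
    by (intro char_poly_similar) (auto simp: similar_mat_def)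
  also have "upper_triangular (M D)"
    by (rule upper_triangularI) (use vs in \<open>auto simp: M_def D_def nth_eq_iff_index_eq\<close>)
  then have "char_poly (M D) = (\<Prod>a\<leftarrow>diag_mat (M D). [:- a, 1:])"
    by (intro char_poly_upper_triangular[of _ n]) simp_all
  also have "diag_mat (M D) = map d vs"
    by (rule nth_equalityI) (use vs in \<open>simp_all add: diag_mat_def M_def D_def\<close>)
  finally show ?thesis
    by (simp only: proots_prod_list_linear M_def mset_map)
qed

section \<open>The Laplacian spectrum of a complete multipartite graph\<close>

lemma sum_replicate_mset: "(\<Sum>x\<in>A. replicate_mset k a) = replicate_mset (card A * k) a"
  by (rule multiset_eqI) (simp add: count_sum)

text \<open>Eigenvectors are indexed by vertices: a chosen representative of each part stands for
  the part as a whole, every other vertex for its difference from the representative. So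
  \<open>B\<close> yields \<open>card B - 1\<close> differences, and the \<open>card P\<close>
  representatives yield the constant function and \<open>card P - 1\<close> comparisons with a fixed
  part.\<close>

lemma laplacian_spectrum_complete_multipartite:
  assumes fin: "finite (pverts H)" and P: "partition_on (pverts H) P" and ne: "P \<noteq> {}"
    and arcs: "parcs H = {(x, y) \<in> pverts H \<times> pverts H. \<forall>B\<in>P. x \<in> B \<longrightarrow> y \<notin> B}"
  shows "laplacian_spectrum H =
    {#0#} + replicate_mset (card P - 1) (real (card (pverts H)))
      + (\<Sum>B\<in>P. replicate_mset (card B - 1) (real (card (pverts H)) - real (card B)))"
proof -
  define V where "V = pverts H"
  define n where "n = real (card V)"
  define m :: "'a set \<Rightarrow> real" where "m B = real (card B)" for B
  have finV: "finite V" and finP: "finite P"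
    using fin finite_elements[OF fin P] by (simp_all add: V_def)
  have V: "V = \<Union>P"
    using P by (simp add: partition_on_def V_def)
  have finB: "finite B" and BV: "B \<subseteq> V" if "B \<in> P" for B
    using that finV V by (auto intro: finite_subset)
  have m_pos: "m B > 0" if "B \<in> P" for B
    using that finB P by (auto simp: m_def card_gt_0_iff partition_on_def)
  \<comment> \<open>From here on \<open>c\<close> maps a vertex to its part and \<open>r\<close>
    maps a part to its representative.\<close>
  have "\<forall>x\<in>V. \<exists>B\<in>P. x \<in> B"
    using V by blast
  then obtain c where c: "\<And>x. x \<in> V \<Longrightarrow> c x \<in> P" "\<And>x. x \<in> V \<Longrightarrow> x \<in> c x"
    by metis
  have c_eq: "x \<in> B \<longleftrightarrow> c x = B" if "x \<in> V" "B \<in> P" for x B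
    using c[of x] that P by (auto simp: partition_on_def disjoint_def)
  have "\<forall>B\<in>P. \<exists>x. x \<in> B"
    using P by (metis ex_in_conv partition_onD3)
  then obtain r where r: "\<And>B. B \<in> P \<Longrightarrow> r B \<in> B"
    by metis
  have rV: "r B \<in> V" if "B \<in> P" for B
    using r that V by blast
  have c_r: "c (r B) = B" if "B \<in> P" for B
    using c_eq[of "r B" B] r rV that by blast
  obtain B0 where B0: "B0 \<in> P"
    using ne by blast
  define v0 where "v0 = r B0"
  have v0: "v0 \<in> V" "c v0 = B0" "r (c v0) = v0"
    using B0 rV c_r by (simp_all add: v0_def)

  txt \<open>The column of \<open>e\<close> at \<open>y\<close> is the eigenvector attached to \<open>y\<close>, with eigenvalue \<open>d y\<close>; the
    representative \<open>v0\<close> of the part \<open>B0\<close> carries the constant function. The rows of \<open>f\<close> are the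
    dual basis.\<close>
  define h where "h x z = (if x = z then n - m (c x) else 0) - (if c x = c z then 0 else 1)" for x z
  define e where "e z y = (if y = v0 then 1
      else if y = r (c y) then of_bool (z \<in> c y) / m (c y) - of_bool (z \<in> B0) / m B0
      else of_bool (z = y) - of_bool (z = r (c y)))" for z y
  define f where "f y z = (if y = v0 then 1 / n
      else if y = r (c y) then of_bool (c z = c y) - m (c y) / n
      else of_bool (z = y) - of_bool (c z = c y) / m (c y))" for y z
  define d where "d y = (if y = v0 then 0 else if y = r (c y) then n else n - m (c y))" for y

  have n_pos: "n > 0"
    using v0 finV by (auto simp: n_def card_gt_0_iff)
  have sum_sub: "(\<Sum>z\<in>V. g z * of_bool (z \<in> B)) = sum g B" if "B \<in> P" for B and g :: "'a \<Rightarrow> real"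
    using BV[OF that] finV by (simp add: of_bool_def if_distrib sum.If_cases Int_absorb1 cong: if_cong)
  have sum_pt: "(\<Sum>z\<in>V. g z * of_bool (z = y)) = g y" if "y \<in> V" for y and g :: "'a \<Rightarrow> real"
    using that finV by (simp add: of_bool_def if_distrib cong: if_cong)
  \<comment> \<open>Pairing an arbitrary \<open>g\<close> with an eigenvector needs only sums of
    \<open>g\<close> over \<open>V\<close> and over parts, and point values. It is used with
    \<open>g\<close> a row of \<open>f\<close> for duality and with \<open>g\<close> a row of
    \<open>h\<close> for the eigenvalue equation.\<close>
  have col: "(\<Sum>z\<in>V. g z * e z y) = (if y = v0 then sum g V
      else if y = r (c y) then sum g (c y) / m (c y) - sum g B0 / m B0
      else g y - g (r (c y)))" if "y \<in> V" for y and g :: "'a \<Rightarrow> real"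
  proof -
    have "(\<Sum>z\<in>V. g z * e z y) = (\<Sum>z\<in>V. g z * of_bool (z \<in> c y)) / m (c y)
        - (\<Sum>z\<in>V. g z * of_bool (z \<in> B0)) / m B0" if "y \<noteq> v0" "y = r (c y)"
      using that by (simp add: e_def right_diff_distrib sum_subtractf sum_divide_distrib)
    moreover have "(\<Sum>z\<in>V. g z * e z y) = (\<Sum>z\<in>V. g z * of_bool (z = y))
        - (\<Sum>z\<in>V. g z * of_bool (z = r (c y)))" if "y \<noteq> v0" "y \<noteq> r (c y)"
      using that by (simp add: e_def right_diff_distrib sum_subtractf)
    moreover have "(\<Sum>z\<in>V. g z * e z y) = sum g V" if "y = v0"
      using that by (simp add: e_def)
    ultimately show ?thesis
      using that c B0 rV by (simp add: sum_sub sum_pt)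
  qed

  have ind_B: "(\<Sum>z\<in>B. of_bool (c z = A)) = (if A = B then m B else 0)"
    if "B \<in> P" for A B
  proof -
    have "(\<Sum>z\<in>B. of_bool (c z = A)) = (\<Sum>z\<in>B. of_bool (A = B) :: real)"
      by (rule sum.cong) (use c_eq BV that in auto)
    then show ?thesis by (simp add: m_def)
  qed
  have ind_V: "(\<Sum>z\<in>V. of_bool (c z = A)) = m A" if "A \<in> P" for A
  proof -
    have "(\<Sum>z\<in>V. of_bool (c z = A)) = (\<Sum>z\<in>V. 1 * of_bool (z \<in> A) :: real)"
      by (rule sum.cong) (use c_eq that in auto)
    then show ?thesis using sum_sub[OF that, of "\<lambda>_. 1"] by (simp add: m_def)
  qed
  have pt_B: "(\<Sum>z\<in>B. of_bool (z = y)) = (of_bool (c y = B) :: real)" if "B \<in> P" "y \<in> V" for B y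
    using that c_eq[of y B] finB by (simp add: of_bool_def)
  have pt_V: "(\<Sum>z\<in>V. of_bool (z = y)) = (1 :: real)" if "y \<in> V" for y
    using sum_pt[OF that, of "\<lambda>_. 1"] by simp

  have fe: "(\<Sum>z\<in>V. f x z * e z y) = (if x = y then 1 else 0)" if x: "x \<in> V" and y: "y \<in> V" for x y
  proof -
    note c' = c(1)[OF x] c(1)[OF y]
    \<comment> \<open>This settles the case of two representatives: they are equal as soon as their
      parts are.\<close>
    have rep: "x = y" if "x = r (c x)" "y = r (c y)" "c x = c y"
      using that by metis
    have f': "f x = (if x = v0 then (\<lambda>z. 1 / n)
      else if x = r (c x) then (\<lambda>z. of_bool (c z = c x) - m (c x) / n)
      else (\<lambda>z. of_bool (z = x) - of_bool (c z = c x) / m (c x)))"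
      by (rule ext) (simp add: f_def)
    have fV: "sum (f x) V = (if x = v0 then 1 else 0)"
      using c' n_pos m_pos[OF c'(1)] x
      by (simp add: f' sum_subtractf sum_divide_distrib[symmetric] ind_V pt_V)
        (simp add: n_def)
    have fB: "sum (f x) B = (if x = v0 then m B / n else if x = r (c x)
        then (if c x = B then m B else 0) - m B * m (c x) / n else 0)" if "B \<in> P" for B
      using c' n_pos m_pos[OF c'(1)] m_pos[OF that] x that
      by (simp add: f' sum_subtractf sum_divide_distrib[symmetric] ind_B pt_B)
        (simp add: m_def)
    show ?thesis
      unfolding col[OF y] fV fB[OF c'(2)] fB[OF B0]
      using c' m_pos[OF c'(1)] m_pos[OF c'(2)] m_pos[OF B0] n_pos v0 rep c_r[OF c'(2)]
      by (auto simp: f_def field_simps)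
  qed
  have he: "(\<Sum>z\<in>V. h x z * e z y) = e x y * d y" if x: "x \<in> V" and y: "y \<in> V" for x y
  proof -
    note c' = c(1)[OF x] c(1)[OF y]
    have h': "h x = (\<lambda>z. of_bool (z = x) * (n - m (c x)) - 1 + of_bool (c z = c x))"
      by (auto simp: h_def)
    \<comment> \<open>Zero row sums make the constant function an eigenvector for 0.\<close>
    have hV: "sum (h x) V = 0"
      using c' x by (simp add: h' sum_subtractf sum.distrib sum_distrib_right[symmetric] ind_V pt_V)
        (simp add: n_def)
    \<comment> \<open>Thus \<open>h\<close> sends the indicator of \<open>B\<close> to n times
      itself minus the constant \<open>m B\<close>. After division by \<open>m B\<close> that
      constant is 1 for every part, so it cancels in the difference of two normalized indicators and
      the eigenvalue \<open>n\<close> remains.\<close>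
    have hB: "sum (h x) B = (if c x = B then n else 0) - m B" if "B \<in> P" for B
      using c' x that by (simp add: h' sum_subtractf sum.distrib sum_distrib_right[symmetric] ind_B pt_B)
        (simp add: m_def)
    show ?thesis
      unfolding col[OF y] hV hB[OF c'(2)] hB[OF B0]
      using m_pos[OF c'(2)] m_pos[OF B0] c_eq[OF x c'(2)] c_eq[OF x B0] c_r[OF c'(2)]
      by (auto simp: h_def e_def d_def field_simps)
  qed

  obtain vs where vs: "distinct vs" "set vs = V"
    using finite_distinct_list[OF finV] by blast
  \<comment> \<open>A vertex is joined to exactly the vertices outside its part; \<open>deg\<close>
    and \<open>adj\<close> identify the explicit \<open>h\<close> with the Laplacian of
    \<open>H\<close>.\<close>
  have deg: "real (out_degree (with_proj H) x) = n - m (c x)" if x: "x \<in> V" for x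
  proof -
    have "out_arcs (with_proj H) x = Pair x ` (V - c x)"
      using x c c_eq by (auto simp: out_arcs_def arcs V_def[symmetric])
    then have "out_degree (with_proj H) x = card (V - c x)"
      by (simp add: out_degree_def card_image inj_on_def)
    also have "\<dots> = card V - card (c x)"
      using c(1)[OF x] finB BV by (intro card_Diff_subset) auto
    finally show ?thesis
      using card_mono[OF finV BV[OF c(1)[OF x]]] by (simp add: n_def m_def)
  qed
  have adj: "(x, y) \<in> parcs H \<longleftrightarrow> c x \<noteq> c y" if "x \<in> V" "y \<in> V" for x y
    using that c c_eq by (auto simp: arcs V_def[symmetric])
  have "laplacian_mat H vs = mat (length vs) (length vs) (\<lambda>(i, j). h (vs ! i) (vs ! j))"
  proof (rule eq_matI)
    fix i j assume "i < dim_row (mat (length vs) (length vs) (\<lambda>(i, j). h (vs ! i) (vs ! j)))"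
      "j < dim_col (mat (length vs) (length vs) (\<lambda>(i, j). h (vs ! i) (vs ! j)))"
    then have ij: "i < length vs" "j < length vs" by simp_all
    then have "vs ! i \<in> V" "vs ! j \<in> V" using vs by auto
    with ij vs show "laplacian_mat H vs $$ (i, j) =
        mat (length vs) (length vs) (\<lambda>(i, j). h (vs ! i) (vs ! j)) $$ (i, j)"
      by (simp add: laplacian_mat_def degree_mat_def adjacency_mat_def h_def deg adj
          nth_eq_iff_index_eq)
  qed (simp_all add: laplacian_mat_def degree_mat_def adjacency_mat_def)
  then have "laplacian_spectrum H = image_mset d (mset vs)"
    using laplacian_spectrum_eq[of vs H] vs fe he
      proots_char_poly_eigenbasis[of vs "length vs" f e h d] by (simp add: V_def)
  also have "\<dots> = (\<Sum>x\<in>V. {#d x#})"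
    using vs(1) unfolding vs(2)[symmetric]
    by (induction vs) simp_all
  also have "\<dots> = (\<Sum>B\<in>P. \<Sum>x\<in>B. {#d x#})"
    unfolding V by (rule sum.Union_disjoint[unfolded comp_def])
      (use finB P in \<open>auto simp: partition_on_def disjoint_def\<close>)
  \<comment> \<open>Only the representative of a part carries the exceptional eigenvalue, 0 or
    \<open>n\<close>; it is split off.\<close>
  also have "\<dots> = (\<Sum>B\<in>P. {#d (r B)#} + replicate_mset (card B - 1) (n - m B))"
  proof (rule sum.cong)
    fix B assume B: "B \<in> P"
    have "(\<Sum>x\<in>B. {#d x#}) = {#d (r B)#} + (\<Sum>x\<in>B - {r B}. {#d x#})"
      using B by (intro sum.remove) (simp_all add: finB r)
    also have "(\<Sum>x\<in>B - {r B}. {#d x#}) = (\<Sum>x\<in>B - {r B}. replicate_mset 1 (n - m B))"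
    proof (rule sum.cong)
      fix x assume x: "x \<in> B - {r B}"
      then have "c x = B" using B BV c_eq by blast
      with x v0 show "{#d x#} = replicate_mset 1 (n - m B)"
        by (auto simp: d_def)
    qed simp
    finally show "(\<Sum>x\<in>B. {#d x#}) = {#d (r B)#} + replicate_mset (card B - 1) (n - m B)"
      using r[OF B] finB[OF B] by (simp add: sum_replicate_mset del: replicate_mset_Suc)
  qed simp
  also have "\<dots> = (\<Sum>B\<in>P. {#d (r B)#}) + (\<Sum>B\<in>P. replicate_mset (card B - 1) (n - m B))"
    by (rule sum.distrib)
  \<comment> \<open>The representative of \<open>B0\<close> is \<open>v0\<close>, the index of the
    constant function, so it gives 0 and all others give \<open>n\<close>.\<close>
  also have "(\<Sum>B\<in>P. {#d (r B)#}) = {#0#} + (\<Sum>B\<in>P - {B0}. {#d (r B)#})"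
    using finP B0 by (subst sum.remove[of _ B0]) (simp_all add: d_def v0_def)
  also have "(\<Sum>B\<in>P - {B0}. {#d (r B)#}) = (\<Sum>B\<in>P - {B0}. replicate_mset 1 n)"
    by (rule sum.cong) (use v0 c_r in \<open>auto simp: d_def\<close>)
  also have "\<dots> = replicate_mset (card P - 1) n"
    using finP B0 by (simp add: sum_replicate_mset del: replicate_mset_Suc)
  finally show ?thesis
    by (simp add: n_def m_def V_def)
qed

section \<open>Groups of order $pq$\<close>

lemma dvd_prime_product_cases:
  fixes k p q :: nat
  assumes "prime p" "prime q" "k dvd p * q" "k \<noteq> 1" "k \<noteq> p * q"
  shows "k = p \<or> k = q"
proof -
  obtain a b where ab: "k = a * b" "a dvd p" "b dvd q"
    using division_decomp[OF assms(3)] by blast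
  then have "a = 1 \<or> a = p" "b = 1 \<or> b = q"
    using assms by (auto simp: prime_nat_iff)
  with ab assms show ?thesis by auto
qed

section \<open>Centralizers and subgroups of prime order\<close>

definition centralizer :: "('a, 'm) monoid_scheme \<Rightarrow> 'a \<Rightarrow> 'a set" where
  "centralizer G x = {y \<in> carrier G. x \<otimes>\<^bsub>G\<^esub> y = y \<otimes>\<^bsub>G\<^esub> x}"

context group
begin

lemma subgroup_centralizer:
  assumes x: "x \<in> carrier G"
  shows "subgroup (centralizer G x) G"
proof (rule subgroupI)
  fix a assume a: "a \<in> centralizer G x"
  then have a: "a \<in> carrier G" "x \<otimes> a = a \<otimes> x"
    by (simp_all add: centralizer_def)
  have "inv a \<otimes> x = inv a \<otimes> (x \<otimes> a) \<otimes> inv a"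
    using a(1) x by (simp add: m_assoc)
  also have "\<dots> = inv a \<otimes> a \<otimes> x \<otimes> inv a"
    unfolding a(2) using a(1) x by (simp only: m_assoc inv_closed m_closed)
  finally show "inv a \<in> centralizer G x"
    using a(1) x by (simp add: centralizer_def)
next
  fix a b assume "a \<in> centralizer G x" "b \<in> centralizer G x"
  then show "a \<otimes> b \<in> centralizer G x"
    using x by (simp add: centralizer_def) (metis m_assoc)
qed (use x in \<open>auto simp: centralizer_def\<close>)

lemma group_centre_eq_INT_centralizer:
  "group_centre G = (\<Inter>x\<in>carrier G. centralizer G x)"
  by (auto simp: group_centre_def centralizer_def)

lemma subgroup_group_centre: "subgroup (group_centre G) G"
  unfolding group_centre_eq_INT_centralizer
  by (rule subgroups_Inter) (auto intro: subgroup_centralizer)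

text \<open>Lagrange's theorem applied in \<open>K\<close> as a group in its own right.\<close>

lemma card_subgroup_dvd:
  assumes "subgroup H G" "subgroup K G" "H \<subseteq> K"
  shows "card H dvd card K"
proof -
  have "group (G\<lparr>carrier := K\<rparr>)"
    using assms(2) by (rule subgroup.subgroup_is_group) (rule group_axioms)
  from group.lagrange[OF this subgroup_incl[OF assms]] show ?thesis
    unfolding Coset.order_def by (simp add: dvdI[of _ _ "card (rcosets\<^bsub>G\<lparr>carrier := K\<rparr>\<^esub> H)"] mult.commute)
qed

text \<open>The order of the intersection divides both primes and is not 1, so the intersection is
  all of \<open>H\<close> and all of \<open>K\<close>.\<close>

lemma prime_card_subgroups_eq:
  assumes H: "subgroup H G" "prime (card H)" and K: "subgroup K G" "prime (card K)"
    and x: "x \<in> H" "x \<in> K" "x \<noteq> \<one>"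
  shows "H = K"
proof -
  have fin: "finite H" "finite K"
    using H(2) K(2) by (auto intro: card_ge_0_finite prime_gt_0_nat)
  have HK: "subgroup (H \<inter> K) G"
    using H(1) K(1) by (rule subgroups_Inter_pair)
  have "card {x, \<one>} \<le> card (H \<inter> K)"
    using x H(1) K(1) fin by (intro card_mono) (auto simp: subgroup.one_closed)
  then have "card (H \<inter> K) \<noteq> 1"
    using x by simp
  moreover have "card (H \<inter> K) dvd card H" "card (H \<inter> K) dvd card K"
    using card_subgroup_dvd HK H(1) K(1) by blast+
  ultimately have eq: "card (H \<inter> K) = card H" "card (H \<inter> K) = card K"
    using H(2) K(2) by (auto simp: prime_nat_iff)
  have "H \<inter> K = H"
    by (rule card_subset_eq[OF fin(1) Int_lower1 eq(1)])
  moreover have "H \<inter> K = K"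
    by (rule card_subset_eq[OF fin(2) Int_lower2 eq(2)])
  ultimately show ?thesis by simp
qed

text \<open>Multiplication is injective on \<open>H \<times> K\<close>: if hk = h'k', then the
  inverse of h' times h equals k' times the inverse of k, an element of both subgroups. The bound
  later excludes a second subgroup of order q.\<close>

lemma card_mult_le_order:
  assumes H: "subgroup H G" and K: "subgroup K G" and triv: "H \<inter> K = {\<one>}"
    and fin: "finite (carrier G)"
  shows "card H * card K \<le> Coset.order G"
proof -
  have HG: "H \<subseteq> carrier G" and KG: "K \<subseteq> carrier G"
    using H K by (auto dest: subgroup.subset)
  have "inj_on (\<lambda>(h, k). h \<otimes> k) (H \<times> K)"
  proof (rule inj_onI, clarify)
    fix h k h' k' assume in_HK: "h \<in> H" "k \<in> K" "h' \<in> H" "k' \<in> K" and eq: "h \<otimes> k = h' \<otimes> k'"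
    then have carr: "h \<in> carrier G" "k \<in> carrier G" "h' \<in> carrier G" "k' \<in> carrier G"
      using HG KG by auto
    have "inv h' \<otimes> h = inv h' \<otimes> (h \<otimes> k) \<otimes> inv k"
      using carr by (simp add: m_assoc)
    also have "\<dots> = k' \<otimes> inv k"
      using carr by (simp add: eq m_assoc[symmetric])
    finally have *: "inv h' \<otimes> h = k' \<otimes> inv k" .
    have "inv h' \<otimes> h \<in> H" "k' \<otimes> inv k \<in> K"
      using in_HK H K by (auto intro: subgroup.m_closed subgroup.m_inv_closed)
    with * triv have "inv h' \<otimes> h = \<one>" "k' \<otimes> inv k = \<one>"
      by auto
    with carr show "h = h' \<and> k = k'"
      by (metis inv_closed inv_equality inv_inv)
  qed
  moreover have "(\<lambda>(h, k). h \<otimes> k) ` (H \<times> K) \<subseteq> carrier G"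
    using HG KG by auto
  ultimately have "card (H \<times> K) \<le> card (carrier G)"
    using fin by (rule card_inj_on_le)
  then show ?thesis
    by (simp add: card_cartesian_product Coset.order_def)
qed

section \<open>Centralizers in a non-abelian group of order pq\<close>

context
  fixes p q :: nat
  assumes prime: "prime p" "prime q"
    and nonabelian: "\<not> comm_group G"
    and card_G: "Coset.order G = p * q"
begin

lemma finite_carrier_pq: "finite (carrier G)"
  using card_G prime by (intro order_gt_0_iff_finite[THEN iffD1]) (simp add: prime_gt_0_nat)

lemma card_proper_subgroup_pq:
  assumes "subgroup H G" "H \<noteq> carrier G" "H \<noteq> {\<one>}"
  shows "card H = p \<or> card H = q"
proof (rule dvd_prime_product_cases[OF prime])
  have HG: "H \<subseteq> carrier G"
    using assms(1) by (rule subgroup.subset)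
  show "card H dvd p * q"
    using lagrange[OF assms(1)] card_G by (metis dvd_triv_right)
  show "card H \<noteq> p * q"
    using card_subset_eq[OF finite_carrier_pq HG] assms(2) card_G by (auto simp: Coset.order_def)
  show "card H \<noteq> 1"
    using assms(3) subgroup.one_closed[OF assms(1)] by (auto simp: card_1_singleton_iff)
qed

lemma prime_card_proper_subgroup_pq:
  assumes "subgroup H G" "H \<noteq> carrier G" "H \<noteq> {\<one>}"
  shows "prime (card H)"
  using card_proper_subgroup_pq[OF assms] prime by auto

text \<open>A nontrivial centre would be properly contained in the centralizer of any noncentral element,
  although both would have prime order.\<close>
lemma group_centre_pq: "group_centre G = {\<one>}"
proof (rule ccontr)
  assume nontriv: "group_centre G \<noteq> {\<one>}"
  have "group_centre G \<noteq> carrier G"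
    using nonabelian group_comm_groupI by (auto simp: group_centre_def)
  then obtain x where x: "x \<in> carrier G" "x \<notin> group_centre G"
    using subgroup.subset[OF subgroup_group_centre] by auto
  obtain z where z: "z \<in> group_centre G" "z \<noteq> \<one>"
    using nontriv subgroup.one_closed[OF subgroup_group_centre] by auto
  have zC: "z \<in> centralizer G x"
    using z(1) x(1) by (auto simp: group_centre_def centralizer_def)
  have xC: "x \<in> centralizer G x"
    using x(1) by (simp add: centralizer_def)
  have "centralizer G x \<noteq> carrier G"
    using x by (auto simp: group_centre_def centralizer_def)
  then have "prime (card (centralizer G x))"
    using prime_card_proper_subgroup_pq[OF subgroup_centralizer[OF x(1)]] zC z(2) by auto
  moreover have "prime (card (group_centre G))"
    using prime_card_proper_subgroup_pq[OF subgroup_group_centre] nontriv x by auto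
  ultimately have "group_centre G = centralizer G x"
    using prime_card_subgroups_eq subgroup_group_centre subgroup_centralizer x(1) z zC by blast
  with x xC show False by simp
qed

text \<open>Since the centre is trivial, \<open>x\<close> is not central and its centralizer is
  proper; it is nontrivial because it contains \<open>x\<close>.\<close>

lemma card_centralizer_pq:
  assumes "x \<in> carrier G" "x \<noteq> \<one>"
  shows "card (centralizer G x) = p \<or> card (centralizer G x) = q"
proof (rule card_proper_subgroup_pq[OF subgroup_centralizer[OF assms(1)]])
  have "x \<notin> group_centre G"
    using assms(2) group_centre_pq by simp
  then show "centralizer G x \<noteq> carrier G"
    using assms(1) by (auto simp: group_centre_def centralizer_def)
  show "centralizer G x \<noteq> {\<one>}"
    using assms by (auto simp: centralizer_def)
qed

text \<open>Both subgroups have prime order and share \<open>x\<close>. Commuting with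
  \<open>x\<close> thereby becomes membership in \<open>H\<close>.\<close>

lemma centralizer_eq_pq:
  assumes "subgroup H G" "prime (card H)" "x \<in> H" "x \<noteq> \<one>"
  shows "centralizer G x = H"
proof -
  have x: "x \<in> carrier G"
    using assms(1,3) by (rule subgroup.mem_carrier)
  then have "x \<in> centralizer G x"
    by (simp add: centralizer_def)
  moreover have "prime (card (centralizer G x))"
    using card_centralizer_pq[OF x assms(4)] prime by auto
  ultimately show ?thesis
    using prime_card_subgroups_eq[OF subgroup_centralizer[OF x] _ assms(1,2)] assms(3,4) by blast
qed

text \<open>A nontrivial y in the centralizer of x has the same centralizer as x, which gives
  disjointness. If such a y lay in \<open>N\<close>, that common centralizer would be
  \<open>N\<close> and would contain x; so the parts avoid \<open>N\<close>.\<close>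

lemma partition_on_centralizers_pq:
  assumes "subgroup N G" "prime (card N)"
  shows "partition_on (carrier G - N) ((\<lambda>x. centralizer G x - {\<one>}) ` (carrier G - N))"
proof -
  have one: "\<one> \<in> N"
    using assms(1) by (rule subgroup.one_closed)
  have prime_C: "prime (card (centralizer G x))" if "x \<in> carrier G - N" for x
    using card_centralizer_pq[of x] that one prime by auto
  have self: "x \<in> centralizer G x - {\<one>}" if "x \<in> carrier G - N" for x
    using that one by (auto simp: centralizer_def)
  have eq: "centralizer G y = centralizer G x"
    if "x \<in> carrier G - N" "y \<in> centralizer G x" "y \<noteq> \<one>" for x y
    using centralizer_eq_pq[OF subgroup_centralizer prime_C] that by auto
  have avoid: "y \<notin> N" if "x \<in> carrier G - N" "y \<in> centralizer G x" "y \<noteq> \<one>" for x y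
    using eq[OF that] centralizer_eq_pq[OF assms, of y] self[of x] that by auto
  show ?thesis
  proof (rule partition_onI)
    show "(\<Union>x\<in>carrier G - N. centralizer G x - {\<one>}) = carrier G - N"
      using self avoid by (auto simp: centralizer_def)
    show "{} \<notin> (\<lambda>x. centralizer G x - {\<one>}) ` (carrier G - N)"
      using self by blast
    fix A B
    assume "A \<in> (\<lambda>x. centralizer G x - {\<one>}) ` (carrier G - N)"
      "B \<in> (\<lambda>x. centralizer G x - {\<one>}) ` (carrier G - N)" "A \<noteq> B"
    then show "disjnt A B"
      unfolding disjnt_iff using eq by blast
  qed
qed

end

end

section \<open>Counting the parts and assembling the spectrum\<close>

theorem proposition4p1:
  fixes G :: "('a, 'm) monoid_scheme" and p q :: nat
  assumes "prime p" and "prime q" and "p dvd q - 1"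
    and "group G" and "\<not> comm_group G" and "Coset.order G = p * q"
  shows "laplacian_spectrum (non_commuting_graph G) =
    {#0#} + replicate_mset (q - 2) (real (p * q) - real q)
          + replicate_mset (p * q - 2 * q) (real (p * q) - real p)
          + replicate_mset q (real (p * q) - 1)"
proof -
  interpret group G by fact
  note pq = \<open>prime p\<close> \<open>prime q\<close> \<open>\<not> comm_group G\<close> \<open>Coset.order G = p * q\<close>
  have fin: "finite (carrier G)"
    using pq by (rule finite_carrier_pq)
  have p2: "p \<ge> 2" and q2: "q \<ge> 2"
    using pq by (simp_all add: prime_ge_2_nat)
  \<comment> \<open>Here q - 1 is positive, so divisibility bounds p by q - 1.\<close>
  have "p < q"
    using dvd_imp_le[OF \<open>p dvd q - 1\<close>] q2 by linarith
  obtain N where N: "subgroup N G" "card N = q"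
    using sylow_thm[of q G 1 p] pq fin \<open>group G\<close> by (auto simp: mult.commute)
  have N_prime: "prime (card N)"
    using N pq by simp
  have one: "\<one>\<^bsub>G\<^esub> \<in> N" and NG: "N \<subseteq> carrier G"
    using N(1) by (auto intro: subgroup.one_closed dest: subgroup.subset)
  have finN: "finite N"
    using NG fin by (rule finite_subset)
  define C where "C x = centralizer G x - {\<one>\<^bsub>G\<^esub>}" for x
  define W where "W = C ` (carrier G - N)"
  have W: "partition_on (carrier G - N) W"
    unfolding W_def C_def using pq N(1) N_prime by (rule partition_on_centralizers_pq)

  have card_W: "card B = p - 1" if B: "B \<in> W" for B
  proof -
    obtain x where x: "x \<in> carrier G" "x \<notin> N" "B = C x"
      using B unfolding W_def by blast
    then have "x \<noteq> \<one>\<^bsub>G\<^esub>"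
      using one by blast
    have sub: "subgroup (centralizer G x) G"
      using x(1) by (rule subgroup_centralizer)
    \<comment> \<open>Otherwise the centralizer, distinct from \<open>N\<close> because it contains
      x, would meet \<open>N\<close> trivially, forcing \<open>q * q \<le> p * q\<close>.\<close>
    have "card (centralizer G x) \<noteq> q"
    proof
      assume cq: "card (centralizer G x) = q"
      have "N \<noteq> centralizer G x"
        using x by (auto simp: centralizer_def)
      then have "N \<inter> centralizer G x = {\<one>\<^bsub>G\<^esub>}"
        using prime_card_subgroups_eq[OF N(1) N_prime sub] cq pq(2) one subgroup.one_closed[OF sub]
        by auto
      from card_mult_le_order[OF N(1) sub this fin] cq N pq \<open>p < q\<close> q2 show False
        by simp
    qed
    then have "card (centralizer G x) = p"
      using card_centralizer_pq[OF pq x(1) \<open>x \<noteq> \<one>\<^bsub>G\<^esub>\<close>] by blast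
    then show ?thesis
      using subgroup.one_closed[OF sub] by (simp add: x(3) C_def)
  qed

  \<comment> \<open>Disjoint parts of size p - 1 cover the pq - q = q(p - 1) elements outside
    \<open>N\<close>; cancelling the positive factor p - 1 leaves q parts.\<close>
  have "card (\<Union>W) = (\<Sum>B\<in>W. card B)"
    using W by (intro card_Union_disjoint)
      (auto simp: partition_on_def intro: finite_subset[OF _ fin])
  moreover have "\<Union>W = carrier G - N"
    using W by (simp add: partition_on_def)
  ultimately have "card W * (p - 1) = card (carrier G - N)"
    by (simp add: card_W)
  also have "\<dots> = q * (p - 1)"
    using pq N NG finN by (simp add: card_Diff_subset Coset.order_def diff_mult_distrib2 mult.commute)
  finally have W_q: "card W = q"
    using p2 by simp
  have finW: "finite W"
    using fin by (simp add: W_def)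

  let ?P = "insert (N - {\<one>\<^bsub>G\<^esub>}) W"
  have card_N1: "card (N - {\<one>\<^bsub>G\<^esub>}) = q - 1"
    using N one by simp
  have N1_ne: "N - {\<one>\<^bsub>G\<^esub>} \<noteq> {}"
  proof
    assume "N - {\<one>\<^bsub>G\<^esub>} = {}"
    then have "q - 1 = 0"
      using card_N1 by (simp only: card.empty)
    with q2 show False by linarith
  qed
  \<comment> \<open>The part coming from \<open>N\<close> is therefore counted separately from those
    in \<open>W\<close>, giving q + 1 parts in all.\<close>
  have N1_notin: "N - {\<one>\<^bsub>G\<^esub>} \<notin> W"
    using W N1_ne by (auto simp: partition_on_def)
  let ?H = "non_commuting_graph G"
  have verts: "pverts ?H = carrier G - {\<one>\<^bsub>G\<^esub>}"
    using group_centre_pq[OF pq] by (simp add: non_commuting_graph_def)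
  have P: "partition_on (pverts ?H) ?P"
  proof -
    have "\<Union>?P = pverts ?H"
      using W one NG by (auto simp: verts partition_on_def)
    moreover have "disjnt (N - {\<one>\<^bsub>G\<^esub>}) B" if "B \<in> W" for B
      using W that by (auto simp: partition_on_def disjnt_def)
    ultimately show ?thesis
      using W N1_ne by (auto simp: partition_on_def pairwise_insert disjnt_sym)
  qed
  have C_mem: "C x \<in> ?P" if "x \<in> pverts ?H" for x
    using that centralizer_eq_pq[OF pq N(1) N_prime, of x] by (auto simp: verts W_def C_def)
  \<comment> \<open>Each vertex lies in exactly one part, namely \<open>C x\<close>; this converts
    non-commutation into lying in different parts.\<close>
  have P_C: "B = C x" if "B \<in> ?P" "x \<in> B" for x B
  proof -
    have x: "x \<in> pverts ?H"
      using partition_onD1[OF P] that by blast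
    then have "x \<in> C x"
      by (auto simp: verts C_def centralizer_def)
    with disjointD[OF partition_onD2[OF P] that(1) C_mem[OF x]] that(2) show ?thesis
      by blast
  qed
  have "parcs ?H = {(x, y) \<in> pverts ?H \<times> pverts ?H. y \<notin> C x}"
    by (auto simp: non_commuting_graph_def C_def centralizer_def group_centre_pq[OF pq])
  also have "\<dots> = {(x, y) \<in> pverts ?H \<times> pverts ?H. \<forall>B\<in>?P. x \<in> B \<longrightarrow> y \<notin> B}"
  proof -
    have "y \<notin> C x \<longleftrightarrow> (\<forall>B\<in>?P. x \<in> B \<longrightarrow> y \<notin> B)" if "x \<in> pverts ?H" for x y
    proof -
      have "x \<in> C x"
        using that by (auto simp: verts C_def centralizer_def)
      with C_mem[OF that] P_C show ?thesis by blast
    qed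
    then show ?thesis by auto
  qed
  finally have arcs: "parcs ?H = \<dots>" .
  have finV: "finite (pverts ?H)"
    using fin by (simp add: verts)
  have card_V: "card (pverts ?H) = p * q - 1"
    using pq by (simp add: verts Coset.order_def)
  have "1 \<le> p * q" using p2 q2 by simp
  then have n: "real (card (pverts ?H)) = real (p * q) - 1"
    by (simp add: card_V of_nat_diff)
  \<comment> \<open>Removing the identity lowers both the number of vertices and the size of each
    part by one, so the two corrections cancel.\<close>
  have eig: "real (p * q) - 1 - real (q - 1) = real (p * q) - real q"
    "real (p * q) - 1 - real (p - 1) = real (p * q) - real p"
    using p2 q2 by (simp_all add: of_nat_diff)
  have "(\<Sum>B\<in>?P. replicate_mset (card B - 1) (real (card (pverts ?H)) - real (card B)))
      = replicate_mset (q - 2) (real (p * q) - real q)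
        + (\<Sum>B\<in>W. replicate_mset (p - 2) (real (p * q) - real p))"
    by (simp only: n sum.insert[OF finW N1_notin] card_N1 card_W eig diff_diff_left one_add_one
        cong: sum.cong)
  \<comment> \<open>The q parts in \<open>W\<close> contribute q(p - 2) = pq - 2q copies; for p = 2
    they are singletons and contribute none.\<close>
  also have "(\<Sum>B\<in>W. replicate_mset (p - 2) (real (p * q) - real p))
      = replicate_mset (p * q - 2 * q) (real (p * q) - real p)"
    by (simp add: sum_replicate_mset W_q diff_mult_distrib2 mult.commute)
  \<comment> \<open>The multiplicity of the eigenvalue pq - 1 is one less than the number q + 1 of
    parts.\<close>
  finally show ?thesis
    using laplacian_spectrum_complete_multipartite[OF finV P _ arcs] finW N1_notin
    unfolding n by (simp add: W_q ac_simps del: of_nat_mult)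
qed

end
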